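(* Let $A$, $B$, $X$ be polynomials with complex coefficients, each of degree at least two. (1) If $A\circ X=X\circ B$, then $X^{-1}(K(A))=K(B)$. (2) Conversely, if $X^{-1}(K(A))=K(B)$ and $\deg A=\deg B$, then there exists a polynomial $\mu$ of degree one such that $(\mu\circ A)\circ X=X\circ B$ and $\mu(K(A))=K(A)$. (3) More generally, if $B$ and $X$ are polynomials of degree at least two and $X^{-1}(K)=K(B)$ holds for some compact set $K\subset\mathbb{C}$, then there exists a polynomial $A$ such that $A\circ X=X\circ B$ and $K(A)=K$.
   Context: For a polynomial $P$ of degree at least two, $K(P)$ denotes the filled-in Julia set of $P$, i.e. the set of points of $\mathbb{C}$ whose orbits under iteration of $P$ are bounded. *)

theory Defs
  imports "HOL-Analysis.Analysis" "HOL-Computational_Algebra.Polynomial"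
begin

text \<open>The definition is total, but it is the filled-in Julia set in the usual sense only when
  \<open>degree P \<ge> 2\<close>.\<close>

definition filled_julia :: "complex poly \<Rightarrow> complex set" where
  "filled_julia P = {z. bounded (range (\<lambda>n. (poly P ^^ n) z))}"

end

theory Submission
  imports Defs "HOL-Computational_Algebra.Fundamental_Theorem_Algebra"
begin

text \<open>
  That a semiconjugacy \<open>A \<circ> X = X \<circ> B\<close> pulls \<open>K(A)\<close> back to \<open>K(B)\<close> is clear:
  \<open>X\<close> maps the \<open>B\<close>-orbit of \<open>z\<close> onto the \<open>A\<close>-orbit of \<open>X(z)\<close>, and a nonconstant polynomial
  preserves and reflects boundedness. The converse rests on Chebyshev's extremal problem.
  Call a polynomial \<open>p\<close> extremal on a compact set \<open>E\<close> if its maximum modulus on \<open>E\<close> is least among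
  all polynomials with the same leading term. On an infinite compact set the extremal polynomial
  with a given leading term is unique (\<open>least_deviation_unique\<close>), because otherwise the midpoint of
  two of them would attain the extremal modulus at too few points, and a perturbation by an
  interpolating polynomial of lower degree would make that modulus smaller.

  Let \<open>E = X\<^sup>-\<^sup>1(K) = K(B)\<close> and \<open>F = X \<circ> B\<close>. As \<open>K(B)\<close> is completely invariant under \<open>B\<close>, also
  \<open>E = F\<^sup>-\<^sup>1(K)\<close>. Averaging over the fibres of a polynomial links extremality on \<open>K\<close> with
  extremality on its preimage: the mean of \<open>q\<close> over the fibre of \<open>f\<close> above \<open>c\<close> is a polynomial
  in \<open>c\<close> (\<open>fibre_sum_is_poly\<close>), and for \<open>c \<in> K\<close> it is bounded by the maximum of \<open>|q|\<close> on
  \<open>f\<^sup>-\<^sup>1(K)\<close>. This is used twice.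

  \<^item> With \<open>f = F\<close>: let \<open>c0\<close> be the centre of the smallest disc that contains \<open>K\<close>. If \<open>q\<close> has
    the leading term of \<open>F\<close>, its mean over fibres of \<open>F\<close> is \<open>c - a\<close> for some constant \<open>a\<close>, and
    the maximum of \<open>|c - a|\<close> on \<open>K\<close> is at least the radius of that disc. Hence \<open>F - c0\<close> is
    extremal on \<open>E\<close> (\<open>least_deviation_vimage\<close>).

  \<^item> With \<open>f = X\<close>: the mean \<open>T\<close> of \<open>F - c0\<close> over the fibres of \<open>X\<close> gives a polynomial \<open>T \<circ> X\<close>
    with the leading term of \<open>F\<close> and no larger maximum on \<open>E\<close>, so uniqueness yields
    \<open>F - c0 = T \<circ> X\<close> (\<open>least_deviation_vimage_factors\<close>).

  Then \<open>A = T + c0\<close> satisfies \<open>A \<circ> X = X \<circ> B\<close>, and \<open>K(A) = K\<close> because both sets have the same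
  preimage under the surjective map \<open>X\<close>. If \<open>K\<close> is itself a filled-in Julia set \<open>K(A)\<close> and the
  semiconjugacy just found is to \<open>A'\<close>, with \<open>deg A' = deg A\<close>, then both \<open>A - c0\<close> and \<open>A' - c0\<close>
  are extremal on \<open>K\<close>, so they are proportional and \<open>A' = \<mu> \<circ> A\<close> with \<open>\<mu>\<close> of degree one.
\<close>

section \<open>Sums over the fibres of a polynomial\<close>

text \<open>The fibre is a multiset: at critical values of \<open>f\<close> the points count with multiplicity,
  which is what makes the sum a polynomial in \<open>c\<close> without exceptional values.\<close>

definition fibre_sum :: "complex poly \<Rightarrow> complex poly \<Rightarrow> complex \<Rightarrow> complex" where
  "fibre_sum f q c = (\<Sum>w\<in>#proots (f - [:c:]). poly q w)"

lemma size_fibre: "size (proots (f - [:c:])) = degree (f :: complex poly)"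
proof -
  have "degree (f - [:c:]) = degree f"
    by (cases f) simp
  then show ?thesis by (simp add: size_proots_complex)
qed

lemma poly_eq_if_mem_fibre:
  assumes "degree (f :: complex poly) > 0" and "w \<in># proots (f - [:c:])"
  shows "poly f w = c"
proof -
  have "f - [:c:] \<noteq> 0" using assms(1) by auto
  with assms(2) show ?thesis by simp
qed

lemma fibre_sum_add: "fibre_sum f (p + q) c = fibre_sum f p c + fibre_sum f q c"
  by (simp add: fibre_sum_def sum_mset.distrib)

lemma fibre_sum_smult: "fibre_sum f (smult a q) c = a * fibre_sum f q c"
  by (simp add: fibre_sum_def sum_mset_distrib_left)

lemma fibre_sum_pcompose_mult:
  assumes "degree f > 0"
  shows "fibre_sum f (pcompose g f * q) c = poly g c * fibre_sum f q c"
proof -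
  have "fibre_sum f (pcompose g f * q) c
      = (\<Sum>w\<in>#proots (f - [:c:]). poly g c * poly q w)"
    unfolding fibre_sum_def
    by (intro arg_cong[of _ _ sum_mset] image_mset_cong)
       (simp add: poly_pcompose poly_eq_if_mem_fibre[OF assms])
  then show ?thesis by (simp add: fibre_sum_def sum_mset_distrib_left)
qed

lemma fibre_sum_pcompose:
  assumes "degree f > 0"
  shows "fibre_sum f (pcompose g f) c = of_nat (degree f) * poly g c"
  using fibre_sum_pcompose_mult[OF assms, of g 1 c]
  by (simp add: fibre_sum_def size_fibre mult.commute)

lemma synthetic_div_smult: "synthetic_div (smult a p) w = smult a (synthetic_div p w)"
  by (induction p) auto

lemma synthetic_div_mult_of_root:
  fixes p q :: "complex poly"
  assumes "poly p w = 0"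
  shows "synthetic_div (q * p) w = q * synthetic_div p w"
proof -
  have "p = [:-w, 1:] * synthetic_div p w"
    using synthetic_div_correct'[of w p] assms by simp
  then have "q * p = [:-w, 1:] * (q * synthetic_div p w)"
    by (metis mult.left_commute)
  then have "q * p + smult w (q * synthetic_div p w) = pCons 0 (q * synthetic_div p w)"
    by simp
  then show ?thesis
    by (metis synthetic_div_unique)
qed

lemma synthetic_div_linear_mult:
  fixes p :: "complex poly"
  shows "synthetic_div ([:-w, 1:] * p) w = p"
proof -
  have "[:-w, 1:] * p + smult w p = pCons 0 p"
    by (simp add: algebra_simps)
  then show ?thesis by (metis synthetic_div_unique)
qed

text \<open>The product rule: the derivative of a product of linear factors is the sum of the products
  with one factor removed, and removing the factor of the root \<open>w\<close> is synthetic division by it.\<close>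

lemma pderiv_prod_linear_eq_sum_synthetic_div:
  fixes A :: "complex multiset"
  shows "pderiv (\<Prod>x\<in>#A. [:-x, 1:]) = (\<Sum>w\<in>#A. synthetic_div (\<Prod>x\<in>#A. [:-x, 1:]) w)"
proof (induction A)
  case (add y A)
  let ?P = "\<Prod>x\<in>#A. [:-x, 1:]"
  have "(\<Sum>w\<in>#A. synthetic_div ([:-y, 1:] * ?P) w) = (\<Sum>w\<in>#A. [:-y, 1:] * synthetic_div ?P w)"
  proof (intro arg_cong[of _ _ sum_mset] image_mset_cong synthetic_div_mult_of_root)
    fix w assume "w \<in># A"
    then obtain A' where "A = add_mset w A'" by (metis mset_add)
    then show "poly ?P w = 0" by simp
  qed
  also have "\<dots> = [:-y, 1:] * pderiv ?P"
    unfolding add.IH by (simp add: sum_mset_distrib_left del: mult_pCons_left)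
  finally have "(\<Sum>w\<in>#A. synthetic_div ([:-y, 1:] * ?P) w) = [:-y, 1:] * pderiv ?P" .
  then show ?case
    by (simp add: synthetic_div_linear_mult pderiv_mult pderiv_pCons del: mult_pCons_left)
qed auto

lemma pderiv_eq_sum_synthetic_div:
  fixes p :: "complex poly"
  shows "pderiv p = (\<Sum>w\<in>#proots p. synthetic_div p w)"
proof -
  let ?P = "\<Prod>x\<in>#proots p. [:-x, 1:]"
  have p: "p = smult (lead_coeff p) ?P"
    by (simp add: complex_poly_decompose_multiset)
  have smult_sum: "smult a (\<Sum>w\<in>#A. g w) = (\<Sum>w\<in>#A. smult a (g w))"
    for a and g :: "complex \<Rightarrow> complex poly" and A
    by (induction A) (auto simp: smult_add_right)
  have "pderiv p = smult (lead_coeff p) (\<Sum>w\<in>#proots p. synthetic_div ?P w)"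
    by (subst p) (simp only: pderiv_smult pderiv_prod_linear_eq_sum_synthetic_div)
  also have "\<dots> = (\<Sum>w\<in>#proots p. smult (lead_coeff p) (synthetic_div ?P w))"
    by (rule smult_sum)
  also have "\<dots> = (\<Sum>w\<in>#proots p. synthetic_div p w)"
    by (simp only: synthetic_div_smult[symmetric] complex_poly_decompose_multiset)
  finally show ?thesis .
qed

text \<open>Seen as functions of \<open>w\<close>, the coefficients of \<open>(p(z) - p(w)) / (z - w)\<close> are the truncations
  of \<open>p\<close>, one of each degree below that of \<open>p\<close>, and they do not involve \<open>p(0)\<close>.\<close>

lemma coeff_synthetic_div: "coeff (synthetic_div p w) i = poly (poly_shift (Suc i) p) w"
proof (induction p arbitrary: i)
  case (pCons a p)
  have sh: "poly_shift (Suc j) (pCons a p) = poly_shift j p" for j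
    by (rule poly_eqI) (simp add: coeff_poly_shift)
  show ?case
    by (cases i) (simp_all add: sh pCons.IH)
qed simp

text \<open>Newton's identities in a linear form. Comparing coefficients in the formula for the
  derivative of \<open>f - c\<close> as a sum of quotients over its roots gives the fibre sums of the
  truncations of \<open>f\<close>, and \<open>c\<close> has disappeared from them.\<close>

lemma fibre_sum_poly_shift:
  "fibre_sum f (poly_shift (Suc i) f) c = coeff (pderiv f) i"
proof -
  have sh: "poly_shift (Suc i) (f - [:c:]) = poly_shift (Suc i) f"
    by (rule poly_eqI) (simp add: coeff_poly_shift coeff_pCons)
  have coeff_sum: "coeff (\<Sum>w\<in>#A. g w) i = (\<Sum>w\<in>#A. coeff (g w) i)"
    for g :: "complex \<Rightarrow> complex poly" and A
    by (induction A) auto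
  have "coeff (pderiv f) i = coeff (pderiv (f - [:c:])) i"
    by (simp add: pderiv_diff pderiv_pCons)
  also have "\<dots> = (\<Sum>w\<in>#proots (f - [:c:]). coeff (synthetic_div (f - [:c:]) w) i)"
    unfolding pderiv_eq_sum_synthetic_div[of "f - [:c:]"] by (rule coeff_sum)
  also have "\<dots> = fibre_sum f (poly_shift (Suc i) f) c"
    by (simp only: fibre_sum_def coeff_synthetic_div sh)
  finally show ?thesis by simp
qed

text \<open>The truncations of \<open>f\<close> have every degree below that of \<open>f\<close>, so they span these
  polynomials, and \<open>fibre_sum_poly_shift\<close> applies to each of them.\<close>

lemma fibre_sum_const_of_degree_less:
  assumes "degree q < degree f"
  shows "fibre_sum f q c = fibre_sum f q c'"
  using assms
proof (induction "degree q" arbitrary: q rule: less_induct)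
  case less
  show ?case
  proof (cases "degree q = 0")
    case True
    then obtain a where "q = [:a:]" by (rule degree_eq_zeroE)
    then show ?thesis by (simp add: fibre_sum_def size_fibre)
  next
    case False
    \<comment> \<open>the truncation \<open>s\<close> of \<open>f\<close> has the degree of \<open>q\<close> and the leading coefficient of \<open>f\<close>\<close>
    define i where "i = degree f - Suc (degree q)"
    define s where "s = poly_shift (Suc i) f"
    define a where "a = lead_coeff q / lead_coeff f"
    have co: "coeff s j = coeff f (j + Suc i)" for j
      by (simp add: s_def coeff_poly_shift)
    have i: "degree q + Suc i = degree f" using less.prems by (simp add: i_def)
    have "lead_coeff f \<noteq> 0" using less.prems by auto
    then have "coeff (q - smult a s) (degree q) = 0"
      using i by (simp add: co a_def)
    moreover have "degree (q - smult a s) \<le> degree q"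
    proof (rule degree_le, intro allI impI)
      fix j assume "degree q < j"
      then have "coeff q j = 0" "coeff f (j + Suc i) = 0"
        using i by (auto intro!: coeff_eq_0)
      then show "coeff (q - smult a s) j = 0" by (simp add: co)
    qed
    ultimately have lt: "degree (q - smult a s) < degree q"
      using False by (metis coeff_0_degree_minus_1 diff_less le_less_trans neq0_conv zero_less_one)
    have split: "fibre_sum f q b = fibre_sum f (q - smult a s) b + a * coeff (pderiv f) i" for b
      using fibre_sum_add[of f "q - smult a s" "smult a s" b]
      by (simp add: fibre_sum_smult s_def fibre_sum_poly_shift)
    show ?thesis
      using less.hyps[OF lt] lt less.prems by (simp add: split[of c] split[of c'])
  qed
qed

text \<open>By division with remainder \<open>q = f u + v\<close>. On the fibre above \<open>c\<close> the factor \<open>f\<close> is the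
  constant \<open>c\<close>, while the fibre sum of \<open>v\<close> does not depend on \<open>c\<close>. The degree
  bound later makes the fibre mean preserve leading terms.\<close>

lemma fibre_sum_is_poly:
  assumes "degree f > 0"
  shows "\<exists>T. (\<forall>c. fibre_sum f q c = poly T c) \<and> degree T * degree f \<le> degree q"
proof (induction "degree q" arbitrary: q rule: less_induct)
  case less
  show ?case
  proof (cases "degree q < degree f")
    case True
    then have "\<forall>c. fibre_sum f q c = poly [:fibre_sum f q 0:] c"
      using fibre_sum_const_of_degree_less by auto
    then show ?thesis by (intro exI[of _ "[:fibre_sum f q 0:]"]) simp
  next
    case False
    define u v where "u = q div f" and "v = q mod f"
    have q: "q = pcompose [:0, 1:] f * u + v"
      by (simp add: u_def v_def pcompose_pCons)
    have dv: "degree v < degree f"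
      unfolding v_def using assms by (metis degree_0 degree_mod_less_degree neq0_conv degree_mod_less')
    have du: "degree q = degree u + degree f"
    proof -
      have "u \<noteq> 0"
        using q dv False by auto
      then have "degree (f * u) = degree f + degree u" using assms by (intro degree_mult_eq) auto
      moreover from this have "degree v < degree (f * u)" using dv by simp
      moreover have "q = f * u + v" by (simp add: u_def v_def)
      ultimately show ?thesis by (simp add: degree_add_eq_left)
    qed
    obtain T where T: "\<And>c. fibre_sum f u c = poly T c" and dT: "degree T * degree f \<le> degree u"
      using less[of u] du assms by auto
    have "fibre_sum f q c = poly ([:fibre_sum f v 0:] + [:0, 1:] * T) c" for c
      using fibre_sum_const_of_degree_less[OF dv, of c 0]
      by (subst q, subst fibre_sum_add, subst fibre_sum_pcompose_mult[OF assms]) (simp add: T)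
    moreover have "degree ([:fibre_sum f v 0:] + [:0, 1:] * T) * degree f \<le> degree q"
    proof -
      have "degree ([:fibre_sum f v 0:] + [:0, 1:] * T) \<le> Suc (degree T)"
        by (simp add: degree_pCons_le)
      then have "degree ([:fibre_sum f v 0:] + [:0, 1:] * T) * degree f \<le> Suc (degree T) * degree f"
        by (rule mult_le_mono1)
      then show ?thesis using dT du by simp
    qed
    ultimately show ?thesis by blast
  qed
qed

lemma norm_fibre_sum_le:
  fixes M :: real
  assumes "degree f > 0" and "\<And>w. poly f w = c \<Longrightarrow> cmod (poly q w) \<le> M"
  shows "cmod (fibre_sum f q c) \<le> degree f * M"
proof -
  have "cmod (\<Sum>w\<in>#A. poly q w) \<le> size A * M" if "\<forall>w\<in>#A. cmod (poly q w) \<le> M" for A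
    using that
  proof (induction A)
    case (add x A)
    then show ?case
      using norm_triangle_ineq[of "poly q x" "\<Sum>w\<in>#A. poly q w"] by (simp add: algebra_simps)
  qed simp
  from this[of "proots (f - [:c:])"] show ?thesis
    using assms poly_eq_if_mem_fibre[OF assms(1)] by (simp add: fibre_sum_def size_fibre)
qed

lemma exists_large_value_on_fibre:
  fixes M :: real
  assumes "degree f > 0" and "degree f * M \<le> cmod (fibre_sum f q c)"
  shows "\<exists>w. poly f w = c \<and> M \<le> cmod (poly q w)"
proof -
  have "\<exists>w\<in>#A. M \<le> cmod (poly q w)"
    if "A \<noteq> {#}" "size A * M \<le> cmod (\<Sum>w\<in>#A. poly q w)" for A
    using that
  proof (induction A)
    case (add x A)
    show ?case
    proof (cases "A = {#} \<or> M \<le> cmod (poly q x)")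
      case False
      then have "size A * M \<le> cmod (\<Sum>w\<in>#A. poly q w)"
        using norm_triangle_ineq[of "poly q x" "\<Sum>w\<in>#A. poly q w"] add.prems(2)
        by (simp add: algebra_simps)
      with False add.IH show ?thesis by auto
    qed (use add.prems in auto)
  qed simp
  moreover have "proots (f - [:c:]) \<noteq> {#}"
    using assms(1) size_fibre[of f c] by auto
  ultimately show ?thesis
    using assms poly_eq_if_mem_fibre[OF assms(1)] size_fibre[of f c]
    unfolding fibre_sum_def by metis
qed

section \<open>Polynomials of least deviation\<close>

text \<open>The radius needed for a disc with centre \<open>a\<close> to contain \<open>K\<close> is a continuous function of \<open>a\<close>
  that is large when \<open>a\<close> is far from \<open>K\<close>, so it has a minimum.\<close>

lemma exists_minimal_enclosing_disc:
  fixes K :: "complex set"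
  assumes "compact K" and "K \<noteq> {}"
  obtains c0 M where "\<And>c. c \<in> K \<Longrightarrow> cmod (c - c0) \<le> M"
    and "\<And>a. \<exists>c\<in>K. M \<le> cmod (c - a)"
proof -
  define rad where "rad = (\<lambda>a. SUP c\<in>K. cmod (c - a))"
  have bdd: "bdd_above ((\<lambda>c. cmod (c - a)) ` K)" for a
    by (intro bounded_imp_bdd_above compact_imp_bounded compact_continuous_image
        continuous_intros assms)
  have le_rad: "cmod (c - a) \<le> rad a" if "c \<in> K" for c a
    unfolding rad_def using that bdd by (rule cSUP_upper)
  have attained: "\<exists>c\<in>K. rad a = cmod (c - a)" for a
  proof -
    have "continuous_on K (\<lambda>c. cmod (c - a))" by (intro continuous_intros)
    then obtain c where c: "c \<in> K" "\<forall>y\<in>K. cmod (y - a) \<le> cmod (c - a)"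
      using continuous_attains_sup[OF assms] by blast
    then have "rad a \<le> cmod (c - a)"
      unfolding rad_def using assms(2) by (intro cSUP_least) auto
    with le_rad[OF c(1)] c(1) show ?thesis by (auto intro: antisym)
  qed
  have lip: "rad a \<le> rad b + dist a b" for a b
  proof -
    obtain c where c: "c \<in> K" "rad a = cmod (c - a)" using attained by blast
    have "cmod (c - a) \<le> cmod (c - b) + cmod (b - a)"
      using norm_triangle_ineq[of "c - b" "b - a"] by simp
    then show ?thesis
      using le_rad[OF c(1), of b] c(2) by (simp add: dist_norm norm_minus_commute)
  qed
  have cont: "continuous_on UNIV rad"
    unfolding continuous_on_iff
  proof (intro ballI allI impI)
    fix a :: complex and e :: real assume "e > 0"
    have "dist (rad b) (rad a) \<le> dist b a" for b
      using lip[of a b] lip[of b a] by (simp add: dist_real_def dist_commute)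
    then show "\<exists>d>0. \<forall>b\<in>UNIV. dist b a < d \<longrightarrow> dist (rad b) (rad a) < e"
      using \<open>e > 0\<close> by (meson le_less_trans)
  qed
  \<comment> \<open>outside the disc around \<open>k\<close> of radius \<open>rad k\<close> the value exceeds \<open>rad k\<close>\<close>
  obtain k where k: "k \<in> K" using assms(2) by blast
  have "continuous_on (cball k (rad k)) rad" using cont continuous_on_subset by blast
  moreover have "k \<in> cball k (rad k)" using le_rad[OF k, of k] by simp
  ultimately obtain c0 where c0: "\<forall>a\<in>cball k (rad k). rad c0 \<le> rad a"
    using continuous_attains_inf[of "cball k (rad k)" rad] by (metis compact_cball empty_iff)
  have min: "rad c0 \<le> rad a" for a
  proof (cases "a \<in> cball k (rad k)")
    case False
    then have "rad k \<le> rad a" using le_rad[OF k, of a] by (simp add: dist_norm)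
    moreover have "rad c0 \<le> rad k" using c0 \<open>k \<in> cball k (rad k)\<close> by blast
    ultimately show ?thesis by simp
  qed (use c0 in blast)
  show ?thesis
  proof (rule that)
    show "cmod (c - c0) \<le> rad c0" if "c \<in> K" for c using that by (rule le_rad)
    show "\<exists>c\<in>K. rad c0 \<le> cmod (c - a)" for a using attained[of a] min[of a] by auto
  qed
qed

text \<open>The polynomials \<open>r\<close> with \<open>degree (r - p) < degree p\<close> are those with the leading term of \<open>p\<close>,
  so for nonconstant \<open>p\<close> and nonempty compact \<open>E\<close> this says that \<open>p\<close> is, up to a constant factor,
  a Chebyshev polynomial of \<open>E\<close>, with \<open>M\<close> its maximum modulus there.\<close>

definition least_deviation :: "complex set \<Rightarrow> complex poly \<Rightarrow> real \<Rightarrow> bool" where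
  "least_deviation E p M \<longleftrightarrow>
     (\<forall>z\<in>E. cmod (poly p z) \<le> M) \<and>
     (\<forall>r. degree (r - p) < degree p \<longrightarrow> (\<exists>z\<in>E. M \<le> cmod (poly r z)))"

lemma exists_interpolating_poly:
  fixes g :: "complex \<Rightarrow> complex"
  assumes "finite Z"
  shows "\<exists>h. degree h \<le> card Z - 1 \<and> (\<forall>z\<in>Z. poly h z = g z)"
  using assms
proof induction
  case empty
  show ?case by (intro exI[of _ 0]) simp
next
  case (insert a Z)
  then obtain h where h: "degree h \<le> card Z - 1" "\<forall>z\<in>Z. poly h z = g z" by blast
  define w where "w = (\<Prod>y\<in>Z. [:-y, 1:])"
  have w0: "poly w z = 0 \<longleftrightarrow> z \<in> Z" for z
    using insert.hyps by (auto simp: w_def poly_prod)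
  have "degree w = card Z"
    by (simp add: w_def degree_prod_sum_eq)
  define h' where "h' = h + smult ((g a - poly h a) / poly w a) w"
  have "degree h' \<le> card Z"
    unfolding h'_def
    by (intro degree_add_le order.trans[OF degree_smult_le]) (use h \<open>degree w = card Z\<close> in auto)
  moreover have "\<forall>z\<in>insert a Z. poly h' z = g z"
    using h w0 insert.hyps by (auto simp: h'_def)
  ultimately show ?case using insert.hyps by (intro exI[of _ h']) simp
qed

text \<open>Kolmogorov's argument. Near the points where \<open>|r| = M\<close> the product \<open>r * cnj h\<close> has real part
  above \<open>M\<^sup>2 / 2\<close>, so subtracting a small multiple of \<open>h\<close> decreases \<open>|r|\<close> to first order there. On the
  rest of \<open>E\<close>, which is compact, \<open>|r|\<close> stays away from \<open>M\<close> and a small change does no harm.\<close>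

lemma exists_perturbation_lowering_max_norm:
  fixes r h :: "'a::topological_space \<Rightarrow> complex"
  assumes "compact E" and cont: "continuous_on E r" "continuous_on E h"
    and le: "\<And>z. z \<in> E \<Longrightarrow> cmod (r z) \<le> M" and "M > 0"
    and eq: "\<And>z. z \<in> E \<Longrightarrow> cmod (r z) = M \<Longrightarrow> h z = r z"
  obtains e :: real where "\<And>z. z \<in> E \<Longrightarrow> cmod (r z - of_real e * h z) < M"
proof -
  obtain H where "H \<ge> 1" and H: "\<And>z. z \<in> E \<Longrightarrow> cmod (h z) \<le> H"
  proof -
    have "bounded (h ` E)"
      using cont assms(1) by (intro compact_imp_bounded compact_continuous_image)
    then obtain b where "\<forall>x\<in>h ` E. cmod x \<le> b" by (auto simp: bounded_iff)
    then show ?thesis by (intro that[of "max b 1"]) auto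
  qed
  define S where "S = E \<inter> {z. Re (r z * cnj (h z)) \<le> M\<^sup>2 / 2}"
  have clo: "closedin (top_of_set E) S"
    unfolding S_def
    by (intro continuous_closedin_preimage[of E "\<lambda>z. Re (r z * cnj (h z))" "{..M\<^sup>2/2}", unfolded vimage_def atMost_iff mem_Collect_eq])
       (auto intro!: continuous_intros cont)
  then have "compact S" using assms(1) closedin_compact by blast
  obtain d where "d > 0" and d: "\<And>z. z \<in> S \<Longrightarrow> cmod (r z) \<le> M - d"
  proof (cases "S = {}")
    case True
    then show ?thesis using that[of 1] by simp
  next
    case False
    have "continuous_on S (\<lambda>z. cmod (r z))"
      using cont by (intro continuous_intros) (auto simp: S_def intro: continuous_on_subset)
    then obtain s where s: "s \<in> S" "\<forall>z\<in>S. cmod (r z) \<le> cmod (r s)"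
      using continuous_attains_sup[OF \<open>compact S\<close> False] by blast
    have "cmod (r s) \<noteq> M"
    proof
      assume "cmod (r s) = M"
      moreover from this have "h s = r s" using s eq by (auto simp: S_def)
      moreover have "Re (r s * cnj (h s)) \<le> M\<^sup>2 / 2" using s by (simp add: S_def)
      ultimately have "M\<^sup>2 \<le> M\<^sup>2 / 2"
        by (metis Re_complex_of_real complex_norm_square of_real_power)
      then show False using \<open>M > 0\<close> by simp
    qed
    then have "cmod (r s) < M" using le[of s] s by (simp add: S_def)
    then show ?thesis using that[of "M - cmod (r s)"] s by simp
  qed
  \<comment> \<open>the first bound serves the set \<open>S\<close>, the second makes the term of order \<open>e\<^sup>2\<close> harmless off \<open>S\<close>\<close>
  define e where "e = min (d / (2 * H)) (M\<^sup>2 / (2 * H\<^sup>2))"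
  have "e > 0" using \<open>d > 0\<close> \<open>H \<ge> 1\<close> \<open>M > 0\<close> by (simp add: e_def)
  have eH: "e * H < d"
  proof -
    have "e * H \<le> d / (2 * H) * H" using \<open>H \<ge> 1\<close> by (intro mult_right_mono) (auto simp: e_def)
    also have "\<dots> < d" using \<open>H \<ge> 1\<close> \<open>d > 0\<close> by simp
    finally show ?thesis .
  qed
  have eH2: "e * H\<^sup>2 < M\<^sup>2"
  proof -
    have "e * H\<^sup>2 \<le> M\<^sup>2 / (2 * H\<^sup>2) * H\<^sup>2" by (intro mult_right_mono) (auto simp: e_def)
    also have "\<dots> < M\<^sup>2" using \<open>H \<ge> 1\<close> \<open>M > 0\<close> by simp
    finally show ?thesis .
  qed
  show ?thesis
  proof (rule that[of e])
    fix z assume z: "z \<in> E"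
    show "cmod (r z - of_real e * h z) < M"
    proof (cases "z \<in> S")
      case True
      have "cmod (r z - of_real e * h z) \<le> cmod (r z) + e * cmod (h z)"
        using norm_triangle_ineq4[of "r z" "of_real e * h z"] \<open>e > 0\<close> by (simp add: norm_mult)
      also have "\<dots> \<le> (M - d) + e * H"
        using d[OF True] H[OF z] \<open>e > 0\<close> by (intro add_mono mult_left_mono) auto
      also have "\<dots> < M" using eH by simp
      finally show ?thesis .
    next
      case False
      then have Re: "Re (r z * cnj (h z)) > M\<^sup>2 / 2" using z by (simp add: S_def)
      have "(cmod (r z - of_real e * h z))\<^sup>2
          = (cmod (r z))\<^sup>2 - 2 * e * Re (r z * cnj (h z)) + e\<^sup>2 * (cmod (h z))\<^sup>2"
        unfolding cmod_power2 by (simp add: power2_eq_square algebra_simps)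
      also have "\<dots> < M\<^sup>2 - 2 * e * (M\<^sup>2 / 2) + e\<^sup>2 * H\<^sup>2"
      proof -
        have "(cmod (r z))\<^sup>2 \<le> M\<^sup>2" using le[OF z] by (intro power_mono) auto
        moreover have "2 * e * (M\<^sup>2 / 2) < 2 * e * Re (r z * cnj (h z))"
          using Re \<open>e > 0\<close> by (intro mult_strict_left_mono) auto
        moreover have "e\<^sup>2 * (cmod (h z))\<^sup>2 \<le> e\<^sup>2 * H\<^sup>2"
          using H[OF z] by (intro mult_left_mono power_mono) auto
        ultimately show ?thesis by linarith
      qed
      also have "\<dots> = M\<^sup>2 - e * (M\<^sup>2 - e * H\<^sup>2)" by (simp add: power2_eq_square algebra_simps)
      also have "\<dots> < M\<^sup>2" using eH2 \<open>e > 0\<close> by simp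
      finally show ?thesis using \<open>M > 0\<close> by (simp add: power_less_imp_less_base)
    qed
  qed
qed

text \<open>By strict convexity of the modulus, the midpoint \<open>r\<close> of \<open>p\<close> and \<open>q\<close> can have modulus \<open>M\<close> only
  where \<open>p\<close> and \<open>q\<close> agree. If \<open>p \<noteq> q\<close> these are at most \<open>degree (q - p)\<close> points, few enough for \<open>r\<close> to
  be interpolated there without touching the leading term, and the perturbed \<open>r\<close> contradicts
  the minimality of \<open>M\<close>.\<close>

lemma least_deviation_unique:
  assumes "compact E" and "infinite E" and p: "least_deviation E p M"
    and q: "\<And>z. z \<in> E \<Longrightarrow> cmod (poly q z) \<le> M" and deg: "degree (q - p) < degree p"
  shows "q = p"
proof (rule ccontr)
  assume "q \<noteq> p"
  define d where "d = q - p"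
  define r where "r = p + smult (1/2) d"
  define Z where "Z = {z \<in> E. cmod (poly r z) = M}"
  have pM: "cmod (poly p z) \<le> M" if "z \<in> E" for z
    using p that by (simp add: least_deviation_def)
  have mean: "poly r z = (poly p z + poly q z) / 2" for z
    by (simp add: r_def d_def field_simps)
  have rM: "cmod (poly r z) \<le> M" if "z \<in> E" for z
    using norm_triangle_ineq[of "poly p z" "poly q z"] pM[OF that] q[OF that]
    by (simp add: mean norm_divide)
  have "poly d z = 0" if "z \<in> Z" for z
  proof -
    have z: "z \<in> E" "cmod (poly p z + poly q z) = 2 * M"
      using that by (auto simp: Z_def mean norm_divide)
    \<comment> \<open>the parallelogram law\<close>
    have "(cmod (poly q z - poly p z))\<^sup>2
        = 2 * (cmod (poly p z))\<^sup>2 + 2 * (cmod (poly q z))\<^sup>2 - (cmod (poly p z + poly q z))\<^sup>2"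
      unfolding cmod_power2 by (simp add: power2_eq_square algebra_simps)
    also have "\<dots> \<le> 2 * M\<^sup>2 + 2 * M\<^sup>2 - (2 * M)\<^sup>2"
      unfolding z(2) using pM[OF z(1)] q[OF z(1)]
      by (intro diff_right_mono add_mono mult_left_mono power_mono) auto
    finally show ?thesis by (simp add: d_def)
  qed
  moreover have "d \<noteq> 0" using \<open>q \<noteq> p\<close> by (simp add: d_def)
  ultimately have sub: "Z \<subseteq> {z. poly d z = 0}" and fin: "finite {z. poly d z = 0}"
    using poly_roots_finite by auto
  then have "finite Z" by (rule finite_subset)
  have "card Z \<le> degree d"
    using card_mono[OF fin sub] card_poly_roots_bound[OF \<open>d \<noteq> 0\<close>] by simp
  obtain h where h: "degree h \<le> card Z - 1" "\<And>z. z \<in> Z \<Longrightarrow> poly h z = poly r z"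
    using exists_interpolating_poly[OF \<open>finite Z\<close>, of "poly r"] by blast
  have "M > 0"
  proof (rule ccontr)
    assume "\<not> M > 0"
    then have "E \<subseteq> Z" using rM by (force simp: Z_def intro: antisym order.trans[OF _ norm_ge_zero])
    then show False using \<open>finite Z\<close> \<open>infinite E\<close> finite_subset by blast
  qed
  obtain e :: real where e: "\<And>z. z \<in> E \<Longrightarrow> cmod (poly r z - of_real e * poly h z) < M"
  proof (rule exists_perturbation_lowering_max_norm[of E "poly r" "poly h" M])
    show "continuous_on E (poly r)" "continuous_on E (poly h)" by (intro continuous_intros)+
    show "poly h z = poly r z" if "z \<in> E" "cmod (poly r z) = M" for z
      using h(2)[of z] that by (simp add: Z_def)
  qed (use \<open>compact E\<close> rM \<open>M > 0\<close> in auto)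
  define s where "s = r - smult (of_real e) h"
  have "s - p = smult (1/2) d - smult (of_real e) h" by (simp add: s_def r_def)
  also have "degree \<dots> < degree p"
    using deg h(1) \<open>card Z \<le> degree d\<close> 
    by (intro degree_diff_less le_less_trans[OF degree_smult_le]) (auto simp: d_def)
  finally obtain z where "z \<in> E" "M \<le> cmod (poly s z)"
    using p by (auto simp: least_deviation_def)
  then show False using e[of z] by (simp add: s_def)
qed

section \<open>Least deviation and preimages\<close>

lemma degree_smult_lead_coeff_diff_less:
  fixes p q :: "complex poly"
  assumes "degree q = degree p" and "degree p > 0"
  shows "degree (smult (lead_coeff p / lead_coeff q) q - p) < degree p"
proof (rule degree_lessI)
  have "q \<noteq> 0" using assms by auto
  then have "lead_coeff q \<noteq> 0" by simp
  then show "\<forall>k\<ge>degree p. coeff (smult (lead_coeff p / lead_coeff q) q - p) k = 0"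
    using assms by (auto simp: le_less coeff_eq_0)
qed (use assms in auto)

text \<open>The fibre mean of a competitor \<open>r\<close> of \<open>F\<close> is \<open>c - a\<close> for a constant \<open>a\<close>, since all terms of
  \<open>r\<close> below the leading one have constant fibre sums. No such \<open>c - a\<close> is smaller on \<open>K\<close> than the
  radius of the minimal enclosing disc, so some value of \<open>r\<close> on a fibre is not either.\<close>

lemma least_deviation_vimage:
  assumes "degree F > 0"
    and disc: "\<And>c. c \<in> K \<Longrightarrow> cmod (c - c0) \<le> M" "\<And>a. \<exists>c\<in>K. M \<le> cmod (c - a)"
  shows "least_deviation (poly F -` K) (F - [:c0:]) M"
  unfolding least_deviation_def
proof (intro conjI allI impI ballI)
  fix z assume "z \<in> poly F -` K"
  then show "cmod (poly (F - [:c0:]) z) \<le> M" using disc(1) by simp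
next
  fix r assume r: "degree (r - (F - [:c0:])) < degree (F - [:c0:])"
  have dF: "degree (F - [:c0:]) = degree F" by (cases F) simp
  define v where "v = r - F"
  have "v = (r - (F - [:c0:])) - [:c0:]" by (simp add: v_def)
  then have dv: "degree v < degree F"
    using r assms(1) by (metis degree_diff_less dF degree_pCons_0)
  define n where "n = (of_nat (degree F) :: complex)"
  have "n \<noteq> 0" using assms(1) by (simp add: n_def)
  define a where "a = - fibre_sum F v 0 / n"
  have sum: "fibre_sum F r c = n * (c - a)" for c
  proof -
    have "r = pcompose [:0, 1:] F + v" by (simp add: v_def pcompose_pCons)
    then have "fibre_sum F r c = n * c + fibre_sum F v c"
      by (simp only: fibre_sum_add fibre_sum_pcompose[OF assms(1)] n_def) simp
    also have "fibre_sum F v c = fibre_sum F v 0"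
      by (rule fibre_sum_const_of_degree_less[OF dv])
    finally show ?thesis using \<open>n \<noteq> 0\<close> by (simp add: a_def field_simps)
  qed
  obtain c where c: "c \<in> K" "M \<le> cmod (c - a)" using disc(2) by blast
  then have "degree F * M \<le> cmod (fibre_sum F r c)"
    by (simp add: sum norm_mult n_def mult_left_mono)
  then obtain w where "poly F w = c" "M \<le> cmod (poly r w)"
    using exists_large_value_on_fibre[OF assms(1)] by blast
  then show "\<exists>z\<in>poly F -` K. M \<le> cmod (poly r z)" using c(1) by auto
qed

text \<open>Averaging \<open>p\<close> over the fibres of \<open>X\<close> does not raise the maximum modulus, because \<open>X\<^sup>-\<^sup>1(K)\<close>
  consists of whole fibres, and it keeps the leading term, because \<open>X\<^sup>n\<close> is its own mean and the
  mean of a polynomial of degree below \<open>n * degree X\<close> is a polynomial in \<open>X\<close> of degree below \<open>n\<close>.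
  By uniqueness \<open>p\<close> equals its mean.\<close>

lemma least_deviation_vimage_factors:
  assumes "compact (poly X -` K)" and "infinite (poly X -` K)"
    and p: "least_deviation (poly X -` K) p M"
    and deg: "degree p = n * degree X" "degree p > 0"
  shows "\<exists>T. p = pcompose T X"
proof -
  let ?m = "of_nat (degree X) :: complex"
  have X: "degree X > 0" using deg by auto
  define b where "b = lead_coeff p / lead_coeff (X ^ n)"
  define v where "v = p - smult b (X ^ n)"
  have "degree (X ^ n) = degree p" using deg X by (subst degree_power_eq) auto
  then have "degree (- v) < degree p"
    using degree_smult_lead_coeff_diff_less[of "X ^ n" p] deg by (simp add: v_def b_def)
  then have dv: "degree v < degree p" by simp
  obtain S where S: "\<And>c. fibre_sum X v c = poly S c" "degree S * degree X \<le> degree v"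
    using fibre_sum_is_poly[OF X] by blast
  define T where "T = smult b (monom 1 n) + smult (1 / ?m) S"
  have "pcompose (monom 1 n) X = X ^ n"
    by (subst poly_eq_poly_eq_iff[symmetric])
       (simp add: fun_eq_iff poly_pcompose poly_monom poly_power)
  then have p_eq: "p = pcompose (smult b (monom 1 n)) X + v"
    by (simp add: v_def pcompose_smult)
  have mean: "poly T c = fibre_sum X p c / ?m" for c
    using X
    by (subst p_eq) (simp add: T_def fibre_sum_add fibre_sum_pcompose S(1) field_simps)
  have "pcompose T X = p"
  proof (rule least_deviation_unique[OF assms(1,2) p])
    fix z assume z: "z \<in> poly X -` K"
    have "cmod (fibre_sum X p (poly X z)) \<le> degree X * M"
      using p z by (intro norm_fibre_sum_le X) (auto simp: least_deviation_def)
    then show "cmod (poly (pcompose T X) z) \<le> M"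
      using X by (simp add: poly_pcompose mean norm_divide field_simps)
  next
    have "pcompose T X - p = smult (1 / ?m) (pcompose S X) - v"
      by (subst p_eq) (simp add: T_def pcompose_add pcompose_smult)
    also have "degree \<dots> < degree p"
      using S(2) dv by (intro degree_diff_less le_less_trans[OF degree_smult_le]) (auto simp: degree_pcompose)
    finally show "degree (pcompose T X - p) < degree p" .
  qed
  then show ?thesis by metis
qed

text \<open>Both \<open>A - c0\<close> and \<open>A' - c0\<close> are extremal on \<open>K\<close> with the same maximum modulus \<open>M\<close>. Scaling one of
  them to the leading term of the other therefore cannot raise the maximum, and uniqueness
  makes them proportional.\<close>

lemma linear_factor_of_common_invariant_set:
  fixes A A' :: "complex poly"
  assumes "compact K" and "infinite K" and inv: "poly A -` K = K" "poly A' -` K = K"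
    and deg: "degree A' = degree A" "degree A > 0"
  shows "\<exists>\<mu>. degree \<mu> = 1 \<and> A' = pcompose \<mu> A"
proof -
  have "K \<noteq> {}" using assms(2) by auto
  then obtain c0 M where disc: "\<And>c. c \<in> K \<Longrightarrow> cmod (c - c0) \<le> M" "\<And>a. \<exists>c\<in>K. M \<le> cmod (c - a)"
    using exists_minimal_enclosing_disc[OF assms(1)] by metis
  define p p' where "p = A - [:c0:]" and "p' = A' - [:c0:]"
  have ld: "least_deviation K p M" "least_deviation K p' M"
    using least_deviation_vimage[OF _ disc, of A] least_deviation_vimage[OF _ disc, of A'] deg
    by (simp_all add: p_def p'_def inv)
  have dp: "degree p = degree A" "degree p' = degree A"
    using deg by (cases A; cases A'; simp add: p_def p'_def)+
  define a where "a = lead_coeff p / lead_coeff p'"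
  have "p \<noteq> 0" "p' \<noteq> 0" using dp deg by auto
  then have "a \<noteq> 0" by (simp add: a_def)
  have scale: "M \<le> cmod b * M"
    if gh: "least_deviation K g M" "least_deviation K h M" "degree (smult b h - g) < degree g" for b g h
  proof -
    obtain z where "z \<in> K" "M \<le> cmod b * cmod (poly h z)"
      using gh(1,3) by (fastforce simp: least_deviation_def norm_mult)
    moreover from this gh(2) have "cmod b * cmod (poly h z) \<le> cmod b * M"
      by (intro mult_left_mono) (auto simp: least_deviation_def)
    ultimately show ?thesis by linarith
  qed
  have da: "degree (smult a p' - p) < degree p"
    unfolding a_def using dp deg by (intro degree_smult_lead_coeff_diff_less) auto
  have "degree (smult (1 / a) p - p') < degree p'"
    using degree_smult_lead_coeff_diff_less[of p p'] dp deg by (simp add: a_def)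
  then have "M \<le> cmod (1 / a) * M" by (rule scale[OF ld(2,1)])
  then have aM: "cmod a * M \<le> M"
    using \<open>a \<noteq> 0\<close> by (simp add: norm_divide field_simps)
  have "smult a p' = p"
  proof (rule least_deviation_unique[OF assms(1,2) ld(1) _ da])
    fix z assume "z \<in> K"
    then have "cmod a * cmod (poly p' z) \<le> cmod a * M"
      using ld(2) by (intro mult_left_mono) (auto simp: least_deviation_def)
    then show "cmod (poly (smult a p') z) \<le> M" using aM by (simp add: norm_mult)
  qed
  then have "p' = smult (1 / a) p" using \<open>a \<noteq> 0\<close> by auto
  then have "A' = [:c0:] + smult (1 / a) (A - [:c0:])"
    by (simp add: p_def p'_def algebra_simps)
  also have "\<dots> = pcompose [:c0 - c0 / a, 1 / a:] A"
    by (simp add: pcompose_pCons smult_diff_right algebra_simps flip: pCons_one)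
  finally have "A' = pcompose [:c0 - c0 / a, 1 / a:] A" .
  moreover have "degree [:c0 - c0 / a, 1 / a:] = 1" using \<open>a \<noteq> 0\<close> by simp
  ultimately show ?thesis by blast
qed

section \<open>Filled-in Julia sets\<close>

lemma bounded_poly_image:
  assumes "bounded S"
  shows "bounded (poly (p :: complex poly) ` S)"
proof -
  obtain r where "\<forall>z\<in>S. cmod z \<le> r" using assms by (auto simp: bounded_iff)
  moreover obtain m where "\<forall>z. cmod z \<le> r \<longrightarrow> cmod (poly p z) \<le> m"
    using poly_bound_exists by blast
  ultimately show ?thesis by (auto simp: bounded_iff)
qed

lemma bounded_poly_vimage:
  fixes p :: "complex poly"
  assumes "degree p > 0" and "bounded S"
  shows "bounded (poly p -` S)"
proof -
  obtain b where b: "\<forall>z\<in>S. cmod z \<le> b" using assms(2) by (auto simp: bounded_iff)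
  obtain a q where p: "p = pCons a q" by (cases p)
  then have "q \<noteq> 0" using assms(1) by auto
  then obtain r where "\<forall>z. r \<le> cmod z \<longrightarrow> b + 1 \<le> cmod (poly p z)"
    using poly_infinity unfolding p by blast
  then have "\<forall>z \<in> poly p -` S. cmod z \<le> r"
    using b by (smt (verit) vimageE)
  then show ?thesis by (auto simp: bounded_iff)
qed

lemma compact_poly_vimage:
  fixes p :: "complex poly"
  assumes "degree p > 0" and "compact K"
  shows "compact (poly p -` K)"
  using assms bounded_poly_vimage
  by (auto simp: compact_eq_bounded_closed intro!: continuous_closed_vimage continuous_intros)

lemma surj_poly:
  fixes p :: "complex poly"
  assumes "degree p > 0"
  shows "surj (poly p)"
  unfolding surj_def
proof
  fix c
  have "degree (p - [:c:]) > 0" using assms by (cases p) (auto split: if_splits)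
  then show "\<exists>z. c = poly p z"
    using alg_closed_imp_poly_has_root[of "p - [:c:]"] by auto
qed

text \<open>Write \<open>B(z) = a + z p(z)\<close> with \<open>p\<close> nonconstant, so that \<open>|p(z)| \<ge> 3\<close> for large \<open>z\<close>.\<close>

lemma poly_escape_radius:
  fixes B :: "complex poly"
  assumes "degree B \<ge> 2"
  obtains R where "R > 0" "\<And>z. R \<le> cmod z \<Longrightarrow> 2 * cmod z \<le> cmod (poly B z)"
proof -
  obtain a b q where B: "B = pCons a (pCons b q)" by (metis pCons_cases)
  with assms have "q \<noteq> 0" by (auto split: if_splits)
  then obtain r where r: "\<forall>z. r \<le> cmod z \<longrightarrow> 3 \<le> cmod (poly (pCons b q) z)"
    using poly_infinity by blast
  show ?thesis
  proof (rule that[of "max 1 (max r (cmod a))"])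
    fix z assume z: "max 1 (max r (cmod a)) \<le> cmod z"
    have "3 * cmod z \<le> cmod (poly (pCons b q) z) * cmod z"
      using r z by (intro mult_right_mono) auto
    also have "\<dots> = cmod (poly B z - a)" by (simp add: B norm_mult mult.commute)
    also have "\<dots> \<le> cmod (poly B z) + cmod a" by (rule norm_triangle_ineq4)
    finally show "2 * cmod z \<le> cmod (poly B z)" using z by simp
  qed simp
qed

text \<open>An orbit that leaves the disc of radius \<open>R\<close> at least doubles its modulus at every later step.\<close>

lemma filled_julia_eq_Inter:
  assumes R: "R > 0" "\<And>z. R \<le> cmod z \<Longrightarrow> 2 * cmod z \<le> cmod (poly B z)"
  shows "filled_julia B = (\<Inter>n. (poly B ^^ n) -` cball 0 R)"
proof (intro equalityI subsetI INT_I)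
  fix z n assume z: "z \<in> filled_julia B"
  then obtain b where b: "\<And>k. cmod ((poly B ^^ k) z) \<le> b"
    by (auto simp: filled_julia_def bounded_iff)
  show "z \<in> (poly B ^^ n) -` cball 0 R"
  proof (rule ccontr)
    assume "z \<notin> (poly B ^^ n) -` cball 0 R"
    then have gt: "cmod ((poly B ^^ n) z) > R" by simp
    have grow: "2 ^ k * R \<le> cmod ((poly B ^^ (k + n)) z)" for k
    proof (induction k)
      case (Suc k)
      have "R \<le> 2 ^ k * R" using R(1) by simp
      then have "2 * cmod ((poly B ^^ (k + n)) z) \<le> cmod ((poly B ^^ (Suc k + n)) z)"
        using R(2) Suc.IH by simp
      with Suc.IH show ?case by simp
    qed (use gt in simp)
    obtain k where "b / R < 2 ^ k" using real_arch_pow[of 2 "b / R"] by auto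
    then have "b < 2 ^ k * R" using R(1) by (simp add: field_simps)
    then show False using grow[of k] b[of "k + n"] by simp
  qed
next
  fix z assume "z \<in> (\<Inter>n. (poly B ^^ n) -` cball 0 R)"
  then show "z \<in> filled_julia B" by (auto simp: filled_julia_def bounded_iff)
qed

lemma compact_filled_julia:
  assumes "degree B \<ge> 2"
  shows "compact (filled_julia B)"
proof -
  obtain R where R: "R > 0" "\<And>z. R \<le> cmod z \<Longrightarrow> 2 * cmod z \<le> cmod (poly B z)"
    using poly_escape_radius[OF assms] by blast
  note eq = filled_julia_eq_Inter[OF R]
  have cont: "continuous_on UNIV (poly B ^^ n)" for n
  proof (induction n)
    case (Suc n)
    then show ?case by (auto simp: o_def intro!: continuous_intros)
  qed (simp add: id_def)
  have "closed ((poly B ^^ n) -` cball 0 R)" for n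
    using cont[of n]
    by (intro continuous_closed_vimage) (auto simp: continuous_on_eq_continuous_at)
  then have "closed (\<Inter>n. (poly B ^^ n) -` cball 0 R)"
    by (intro closed_INT) simp
  then have "closed (filled_julia B)"
    by (simp only: eq)
  moreover have "filled_julia B \<subseteq> cball 0 R"
    using INT_lower[of 0 UNIV "\<lambda>n. (poly B ^^ n) -` cball 0 R"] by (simp add: eq)
  ultimately show ?thesis
    using bounded_subset bounded_cball by (auto simp: compact_eq_bounded_closed)
qed

lemma vimage_filled_julia: "poly B -` filled_julia B = filled_julia B"
proof -
  have "range (\<lambda>n. (poly B ^^ n) z) = insert z (range (\<lambda>n. (poly B ^^ n) (poly B z)))" for z
  proof -
    have "(UNIV :: nat set) = insert 0 (range Suc)" by (metis UNIV_nat_eq)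
    then have "range (\<lambda>n. (poly B ^^ n) z) = (\<lambda>n. (poly B ^^ n) z) ` insert 0 (range Suc)"
      by simp
    also have "\<dots> = insert z (range (\<lambda>n. (poly B ^^ n) (poly B z)))"
      by (simp add: image_image funpow_swap1)
    finally show ?thesis .
  qed
  then have "bounded (range (\<lambda>n. (poly B ^^ n) z)) \<longleftrightarrow> bounded (range (\<lambda>n. (poly B ^^ n) (poly B z)))" for z
    by (metis bounded_insert)
  then show ?thesis unfolding filled_julia_def by blast
qed

lemma poly_mem_filled_julia_iff: "poly B z \<in> filled_julia B \<longleftrightarrow> z \<in> filled_julia B"
  using eqset_imp_iff[OF vimage_filled_julia[of B], of z] by simp

lemma vimage_filled_julia_semiconjugacy:
  fixes A B X :: "complex poly"
  assumes "degree X > 0" and "pcompose A X = pcompose X B"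
  shows "poly X -` filled_julia A = filled_julia B"
proof -
  have "poly A (poly X z) = poly X (poly B z)" for z
    using assms(2) by (metis poly_pcompose)
  then have "(poly A ^^ n) (poly X z) = poly X ((poly B ^^ n) z)" for n z
    by (induction n) auto
  then have orbit: "range (\<lambda>n. (poly A ^^ n) (poly X z)) = poly X ` range (\<lambda>n. (poly B ^^ n) z)" for z
    by (simp add: image_image)
  have "bounded (poly X ` S) \<longleftrightarrow> bounded S" for S
  proof
    assume "bounded (poly X ` S)"
    then have "bounded (poly X -` (poly X ` S))" by (rule bounded_poly_vimage[OF assms(1)])
    then show "bounded S" by (rule bounded_subset) auto
  qed (rule bounded_poly_image)
  then show ?thesis by (simp add: filled_julia_def orbit)
qed

text \<open>Suppose the set is finite. Being completely invariant, it is permuted by \<open>B\<close>, so each of its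
  points \<open>e\<close> is the only preimage of \<open>B(e)\<close> and hence \<open>B(z) = B(e) + b (z - e)\<^sup>d\<close>. The derivative then
  vanishes at \<open>e\<close> only, which leaves a single point. That point is a superattracting
  fixed point, so a whole disc around it has bounded orbits.\<close>

lemma infinite_filled_julia:
  assumes "degree B \<ge> 2"
  shows "infinite (filled_julia B)"
proof
  assume fin: "finite (filled_julia B)"
  let ?E = "filled_julia B"
  define b where "b = lead_coeff B"
  have "surj (poly B)" using assms by (intro surj_poly) simp
  then have "poly B ` (poly B -` ?E) = ?E" by (rule surj_image_vimage_eq)
  then have "poly B ` ?E = ?E" by (simp only: vimage_filled_julia)
  then have inj: "inj_on (poly B) ?E" using fin by (simp add: eq_card_imp_inj_on)
  have B: "B = smult b ([:-e, 1:] ^ degree B) + [:poly B e:]" if e: "e \<in> ?E" for e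
  proof -
    define P where "P = B - [:poly B e:]"
    have dP: "degree P = degree B"
      unfolding P_def by (cases B) simp
    then have lP: "lead_coeff P = b"
      using assms by (simp add: P_def b_def coeff_pCons split: nat.splits)
    have "P \<noteq> 0" using dP assms by auto
    have "w = e" if "w \<in># proots P" for w
    proof -
      have "poly B w = poly B e" using that \<open>P \<noteq> 0\<close> by (simp add: P_def)
      then have "w \<in> ?E" using e poly_mem_filled_julia_iff[of B] by metis
      with inj e \<open>poly B w = poly B e\<close> show ?thesis by (auto dest: inj_onD)
    qed
    then have "filter_mset (\<lambda>w. w = e) (proots P) = proots P"
      by (simp add: filter_mset_eq_conv)
    then have "proots P = replicate_mset (degree B) e"
      by (metis filter_eq_replicate_mset size_replicate_mset size_proots_complex dP)
    then have "P = smult b ([:-e, 1:] ^ degree B)"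
      using complex_poly_decompose_multiset[of P] by (simp add: lP)
    then show ?thesis by (simp add: P_def algebra_simps)
  qed
  obtain e where e: "e \<in> ?E"
  proof -
    have "degree (B + - [:0, 1:]) = degree B"
      using assms by (intro degree_add_eq_left) simp
    then have "degree (B - [:0, 1:]) = degree B" by (simp only: add_uminus_conv_diff)
    then obtain z where "poly B z = z"
      using alg_closed_imp_poly_has_root[of "B - [:0, 1:]"] assms by auto
    then have "(poly B ^^ n) z = z" for n by (induction n) auto
    then show ?thesis using that[of z] by (simp add: filled_julia_def)
  qed
  have "pderiv B = pderiv (smult b ([:-x, 1:] ^ degree B))" if "x \<in> ?E" for x
    by (subst B[OF that]) (simp add: pderiv_add pderiv_pCons)
  then have dB: "poly (pderiv B) z = of_nat (degree B) * b * (z - x) ^ (degree B - 1)"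
    if "x \<in> ?E" for x z
    using that by (simp add: pderiv_smult pderiv_power pderiv_pCons mult_ac)
  have "b \<noteq> 0" using assms by (auto simp: b_def)
  \<comment> \<open>as \<open>degree B \<ge> 2\<close>, the derivative vanishes at \<open>e\<close>, and by the formula based at \<open>x\<close> only at \<open>x\<close>\<close>
  have single: "x = e" if "x \<in> ?E" for x
    using dB[OF that, of e] dB[OF e, of e] assms \<open>b \<noteq> 0\<close> by (auto simp: power_0_left)
  have fixed: "poly B e = e" using single e poly_mem_filled_julia_iff by blast
  have Bz: "cmod (poly B z - e) = cmod b * cmod (z - e) ^ degree B" for z
    by (subst B[OF e]) (simp add: poly_power norm_mult norm_power fixed)
  \<comment> \<open>\<open>|B(z) - e| = |b| |z - e|\<^sup>d\<close> is at most \<open>|z - e|\<close> once \<open>|z - e| \<le> 1\<close> and \<open>|b| |z - e| \<le> 1\<close>\<close>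
  define \<rho> where "\<rho> = min 1 (1 / cmod b)"
  have \<rho>: "\<rho> > 0" "\<rho> \<le> 1" "cmod b * \<rho> \<le> 1" using \<open>b \<noteq> 0\<close> by (auto simp: \<rho>_def min_def field_simps)
  have step: "cmod (poly B z - e) \<le> \<rho>" if z: "cmod (z - e) \<le> \<rho>" for z
  proof -
    have "cmod b * cmod (z - e) ^ degree B \<le> cmod b * cmod (z - e) ^ 2"
      using z \<rho> assms by (intro mult_left_mono power_decreasing) auto
    also have "\<dots> \<le> cmod b * \<rho> ^ 2" using z by (intro mult_left_mono power_mono) auto
    also have "\<dots> \<le> 1 * \<rho>"
      using mult_right_mono[OF \<rho>(3), of \<rho>] \<rho>(1) by (simp add: power2_eq_square mult.assoc)
    finally show ?thesis by (simp add: Bz)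
  qed
  have "cball e \<rho> \<subseteq> ?E"
  proof
    fix z assume "z \<in> cball e \<rho>"
    then have "cmod (z - e) \<le> \<rho>" by (simp add: dist_norm norm_minus_commute)
    then have "cmod ((poly B ^^ n) z - e) \<le> \<rho>" for n
      by (induction n) (auto intro: step)
    then have "range (\<lambda>n. (poly B ^^ n) z) \<subseteq> cball e \<rho>"
      by (auto simp: dist_norm norm_minus_commute)
    then show "z \<in> ?E" using bounded_cball bounded_subset by (auto simp: filled_julia_def)
  qed
  then have "e + of_real \<rho> \<in> ?E" using \<rho>(1) by (auto simp: dist_norm)
  then show False using single[of "e + of_real \<rho>"] \<rho>(1) by simp
qed

section \<open>Semiconjugacies and preimages of filled-in Julia sets\<close>

text \<open>Complete invariance of \<open>K(B)\<close> gives \<open>(X \<circ> B)\<^sup>-\<^sup>1(K) = X\<^sup>-\<^sup>1(K)\<close>. Hence \<open>X \<circ> B\<close> minus the centre of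
  the minimal disc of \<open>K\<close> is extremal on a set that is saturated for \<open>X\<close>, and so it factors
  through \<open>X\<close>.\<close>

lemma semiconjugacy_of_vimage_eq_filled_julia:
  fixes B X :: "complex poly"
  assumes "degree B \<ge> 2" and "degree X > 0" and "compact K"
    and vim: "poly X -` K = filled_julia B"
  shows "\<exists>A. pcompose A X = pcompose X B \<and> filled_julia A = K"
proof -
  define F where "F = pcompose X B"
  have dF: "degree F = degree B * degree X" "degree F > 0"
    using assms by (simp_all add: F_def degree_pcompose)
  have "K \<noteq> {}" using infinite_filled_julia[OF assms(1)] vim by auto
  then obtain c0 M where disc: "\<And>c. c \<in> K \<Longrightarrow> cmod (c - c0) \<le> M" "\<And>a. \<exists>c\<in>K. M \<le> cmod (c - a)"
    using exists_minimal_enclosing_disc[OF assms(3)] by metis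
  have "poly F -` K = poly X -` K"
    using vim vimage_filled_julia[of B] by (auto simp: F_def poly_pcompose vimage_def)
  then have "least_deviation (poly X -` K) (F - [:c0:]) M"
    using least_deviation_vimage[OF dF(2) disc] by simp
  moreover have "degree (F - [:c0:]) = degree F" by (cases F) simp
  ultimately obtain T where T: "F - [:c0:] = pcompose T X"
    using least_deviation_vimage_factors[of X K "F - [:c0:]" M "degree B"] dF
      compact_filled_julia[OF assms(1)] infinite_filled_julia[OF assms(1)] by (auto simp: vim)
  have "pcompose (T + [:c0:]) X = F"
    by (simp add: pcompose_add T[symmetric])
  then have A: "pcompose (T + [:c0:]) X = pcompose X B" by (simp add: F_def)
  have "poly X -` filled_julia (T + [:c0:]) = poly X -` K"
    using vimage_filled_julia_semiconjugacy[OF assms(2) A] vim by simp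
  then have "filled_julia (T + [:c0:]) = K"
    using surj_poly[OF assms(2)] by (metis surj_image_vimage_eq)
  with A show ?thesis by blast
qed

theorem theorem1p1:
  fixes B X :: "complex poly"
  assumes "degree B \<ge> 2" and "degree X \<ge> 2"
  shows
    "(\<forall>A :: complex poly. degree A \<ge> 2 \<longrightarrow>
        pcompose A X = pcompose X B \<longrightarrow>
        poly X -` filled_julia A = filled_julia B) \<and>
     (\<forall>A :: complex poly. degree A \<ge> 2 \<longrightarrow>
        poly X -` filled_julia A = filled_julia B \<longrightarrow> degree A = degree B \<longrightarrow>
        (\<exists>\<mu> :: complex poly. degree \<mu> = 1 \<and>
           pcompose (pcompose \<mu> A) X = pcompose X B \<and>
           poly \<mu> ` filled_julia A = filled_julia A)) \<and>
     (\<forall>K :: complex set. compact K \<longrightarrow> poly X -` K = filled_julia B \<longrightarrow>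
        (\<exists>A :: complex poly. pcompose A X = pcompose X B \<and> filled_julia A = K))"
proof (intro conjI allI impI)
  have X: "degree X > 0" using assms(2) by simp
  fix A :: "complex poly"
  assume "pcompose A X = pcompose X B"
  then show "poly X -` filled_julia A = filled_julia B"
    by (rule vimage_filled_julia_semiconjugacy[OF X])
next
  have X: "degree X > 0" using assms(2) by simp
  fix A :: "complex poly"
  assume A: "degree A \<ge> 2" "poly X -` filled_julia A = filled_julia B" "degree A = degree B"
  obtain A' where A': "pcompose A' X = pcompose X B" "filled_julia A' = filled_julia A"
    using semiconjugacy_of_vimage_eq_filled_julia[OF assms(1) X compact_filled_julia[OF A(1)] A(2)]
    by blast
  have "degree A' * degree X = degree X * degree B"
    using A'(1) by (metis degree_pcompose)
  then have deg: "degree A' = degree A" using X A(3) by simp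
  obtain \<mu> where \<mu>: "degree \<mu> = 1" "A' = pcompose \<mu> A"
    using linear_factor_of_common_invariant_set[OF compact_filled_julia[OF A(1)]
        infinite_filled_julia[OF A(1)] vimage_filled_julia, of A'] A(1) deg
      vimage_filled_julia[of A'] A'(2) by auto
  have image: "poly P ` filled_julia P = filled_julia P" if "degree P > 0" for P
    using surj_image_vimage_eq[OF surj_poly[OF that], of "filled_julia P"]
    by (simp only: vimage_filled_julia)
  have "poly \<mu> ` filled_julia A = poly \<mu> ` (poly A ` filled_julia A)"
    using image[of A] A(1) by simp
  also have "\<dots> = poly A' ` filled_julia A'"
    by (simp add: \<mu>(2) A'(2)[unfolded \<mu>(2)] image_image poly_pcompose)
  also have "\<dots> = filled_julia A" using image[of A'] deg A(1) A'(2) by simp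
  finally show "\<exists>\<mu>. degree \<mu> = 1 \<and> pcompose (pcompose \<mu> A) X = pcompose X B \<and>
      poly \<mu> ` filled_julia A = filled_julia A"
    using \<mu> A'(1) by blast
next
  fix K :: "complex set"
  assume "compact K" "poly X -` K = filled_julia B"
  then show "\<exists>A. pcompose A X = pcompose X B \<and> filled_julia A = K"
    using assms by (intro semiconjugacy_of_vimage_eq_filled_julia) auto
qed

end
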